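(* For every $d\ge2$, every horizon $T\ge d-1$, and every online algorithm on $\Delta_d$, an adaptive adversary can choose loss vectors $c_1,\dots,c_T\in[-1,1]^d$ such that $$\mathrm{Reg}_{\mathrm{Alt}}^T\ge 2\left(\sum_{m=1}^d\frac1m-1\right)=2\log d-O(1),$$ where the $O(1)$ term is bounded by an absolute constant.
   Context: $\Delta_d=\{x\in\mathbb R^d:x_i\ge0,\ \sum_ix_i=1\}$. In each round $t=1,\dots,T$ the online algorithm chooses $x_t\in\Delta_d$ based on $c_1,\dots,c_{t-1}$; then the adaptive adversary, having observed $x_1,\dots,x_t$, chooses $c_t\in[-1,1]^d$, which is revealed to the algorithm. With $c_0=0$, $$\mathrm{Reg}_{\mathrm{Alt}}^T=\sum_{t=1}^T(c_{t-1}+c_t)^\top x_t-\min_{x\in\Delta_d}\sum_{t=1}^T(c_{t-1}+c_t)^\top x .$$ *)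

theory Defs
  imports "HOL-Analysis.Analysis"
begin

definition prob_simplex :: "(real ^ 'd) set" where
  "prob_simplex = {x. (\<forall>i. 0 \<le> x $ i) \<and> (\<Sum>i\<in>UNIV. x $ i) = 1}"

definition loss_cube :: "(real ^ 'd) set" where
  "loss_cube = {c. \<forall>i. -1 \<le> c $ i \<and> c $ i \<le> 1}"

text \<open>
  A strategy maps what its player has observed, listed with the oldest vector first, to the
  player's next move. The algorithm sees \<open>[c\<^sub>1, \<dots>, c\<^sub>t\<^sub>-\<^sub>1]\<close> before choosing \<open>x\<^sub>t\<close>; the adversary
  sees \<open>[x\<^sub>1, \<dots>, x\<^sub>t]\<close> before choosing \<open>c\<^sub>t\<close>. Its own earlier losses are determined by these.
\<close>

definition online_algorithm :: "((real ^ 'd) list \<Rightarrow> real ^ 'd) \<Rightarrow> bool" where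
  "online_algorithm alg \<longleftrightarrow> (\<forall>cs \<in> lists loss_cube. alg cs \<in> prob_simplex)"

definition adaptive_adversary :: "((real ^ 'd) list \<Rightarrow> real ^ 'd) \<Rightarrow> bool" where
  "adaptive_adversary adv \<longleftrightarrow> (\<forall>xs \<in> lists prob_simplex. adv xs \<in> loss_cube)"

text \<open>The pair \<open>([x\<^sub>1, \<dots>, x\<^sub>t], [c\<^sub>1, \<dots>, c\<^sub>t])\<close> produced by the first \<open>t\<close> rounds.\<close>

primrec transcript ::
  "((real ^ 'd) list \<Rightarrow> real ^ 'd) \<Rightarrow> ((real ^ 'd) list \<Rightarrow> real ^ 'd) \<Rightarrow> nat
    \<Rightarrow> (real ^ 'd) list \<times> (real ^ 'd) list" where
  "transcript alg adv 0 = ([], [])"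
| "transcript alg adv (Suc t) =
     (let (xs, cs) = transcript alg adv t; xs' = xs @ [alg cs] in (xs', cs @ [adv xs']))"

text \<open>Rounds are numbered from 1, so \<open>played_action\<close> is only meaningful for \<open>t \<ge> 1\<close>.\<close>

definition played_action ::
  "((real ^ 'd) list \<Rightarrow> real ^ 'd) \<Rightarrow> ((real ^ 'd) list \<Rightarrow> real ^ 'd) \<Rightarrow> nat \<Rightarrow> real ^ 'd" where
  "played_action alg adv t = last (fst (transcript alg adv t))"

definition played_loss ::
  "((real ^ 'd) list \<Rightarrow> real ^ 'd) \<Rightarrow> ((real ^ 'd) list \<Rightarrow> real ^ 'd) \<Rightarrow> nat \<Rightarrow> real ^ 'd" where
  "played_loss alg adv t = (if t = 0 then 0 else last (snd (transcript alg adv t)))"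

definition alt_regret :: "nat \<Rightarrow> (nat \<Rightarrow> real ^ 'd) \<Rightarrow> (nat \<Rightarrow> real ^ 'd) \<Rightarrow> real" where
  "alt_regret T x c =
     (\<Sum>t = 1..T. (c (t - 1) + c t) \<bullet> x t)
     - (INF u \<in> prob_simplex. \<Sum>t = 1..T. (c (t - 1) + c t) \<bullet> u)"

text \<open>The infimum in the regret is a minimum.\<close>

lemma compact_prob_simplex: "compact (prob_simplex :: (real ^ 'd) set)"
proof -
  have "closed (prob_simplex :: (real ^ 'd) set)"
    unfolding prob_simplex_def
    by (intro closed_Collect_conj closed_Collect_all closed_Collect_le closed_Collect_eq
        continuous_intros)
  moreover have "norm x \<le> 1" if "x \<in> prob_simplex" for x :: "real ^ 'd"
    using norm_le_l1_cart[of x] that by (simp add: prob_simplex_def)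
  ultimately show ?thesis
    by (auto simp: compact_eq_bounded_closed bounded_iff)
qed

lemma prob_simplex_nonempty: "(prob_simplex :: (real ^ 'd) set) \<noteq> {}"
proof -
  have "axis undefined 1 \<in> (prob_simplex :: (real ^ 'd) set)"
    by (simp add: prob_simplex_def axis_def)
  then show ?thesis by blast
qed

lemma alt_regret_min_attained:
  fixes c :: "nat \<Rightarrow> real ^ 'd" and T :: nat
  defines "L \<equiv> \<lambda>u. \<Sum>t = 1..T. (c (t - 1) + c t) \<bullet> u"
  shows "\<exists>u \<in> prob_simplex. L u = (INF v \<in> prob_simplex. L v) \<and> (\<forall>v \<in> prob_simplex. L u \<le> L v)"
proof -
  have "continuous_on prob_simplex L"
    unfolding L_def by (intro continuous_intros)
  then obtain u where u: "u \<in> prob_simplex" "\<forall>v \<in> prob_simplex. L u \<le> L v"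
    using continuous_attains_inf[OF compact_prob_simplex prob_simplex_nonempty] by blast
  then have "(INF v \<in> prob_simplex. L v) = L u"
    by (intro cInf_eq_minimum) auto
  with u show ?thesis by metis
qed

end

theory Submission
  imports Defs
begin

text \<open>
  The adversary keeps a set of surviving coordinates, initially all of them. In each round it
  eliminates the survivor carrying the most mass of the algorithm's move, until one is left, and
  plays loss \<open>-1\<close> on the survivors and \<open>1\<close> elsewhere. Compared with the last survivor, the algorithm
  pays twice its mass on the coordinates eliminated before the round and twice its mass on those
  eliminated after it. While \<open>m\<close> coordinates survive, the latter mass is at least \<open>1 / m\<close>, so the
  first \<open>d - 1\<close> rounds cost \<open>2 / d + 2 / (d - 1) + \<dots> + 2 / 2\<close>, and no later round reduces the
  regret.
\<close>

definition eliminate :: "'d set \<Rightarrow> real ^ 'd \<Rightarrow> 'd set" where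
  "eliminate A x = (if card A \<le> 1 then A else A - {arg_min_on (\<lambda>i. - x $ i) A})"

text \<open>Depends on the moves alone, so \<open>elimination_loss (survivors xs)\<close> can serve
  as the adversary's strategy.\<close>

definition survivors :: "(real ^ 'd) list \<Rightarrow> 'd set" where
  "survivors xs = foldl eliminate UNIV xs"

definition elimination_loss :: "'d set \<Rightarrow> real ^ 'd" where
  "elimination_loss A = (\<chi> i. if i \<in> A then - 1 else 1)"

lemma survivors_Nil [simp]: "survivors [] = UNIV"
  by (simp add: survivors_def)

lemma survivors_snoc [simp]: "survivors (xs @ [x]) = eliminate (survivors xs) x"
  by (simp add: survivors_def)

lemma eliminate_subset: "eliminate A x \<subseteq> A"
  by (auto simp: eliminate_def)

text \<open>The heaviest coordinate is encoded as a minimiser of the negated entries; finiteness of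
  \<open>A\<close> guarantees that it exists.\<close>

lemma heaviest_coordinate:
  fixes A :: "'d::finite set"
  assumes "A \<noteq> {}"
  shows "arg_min_on (\<lambda>i. - x $ i) A \<in> A"
    and "k \<in> A \<Longrightarrow> x $ k \<le> (x $ arg_min_on (\<lambda>i. - x $ i) A :: real)"
  using arg_min_if_finite[of A "\<lambda>i. - x $ i"] assms by force+

lemma card_eliminate:
  fixes A :: "'d::finite set"
  assumes "A \<noteq> {}"
  shows "card (eliminate A x) = max 1 (card A - 1)"
proof -
  have "0 < card A"
    using assms by (simp add: card_gt_0_iff)
  then show ?thesis
    using heaviest_coordinate(1)[OF assms] by (auto simp: eliminate_def)
qed

lemma card_survivors:
  fixes xs :: "(real ^ 'd) list"
  shows "card (survivors xs) = max 1 (CARD('d::finite) - length xs)"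
proof (induction xs rule: rev_induct)
  case Nil
  then show ?case
    using zero_less_card_finite[where 'a = 'd] by simp
next
  case (snoc x xs)
  then have "survivors xs \<noteq> {}"
    by auto
  from card_eliminate[OF this, of x] show ?case
    unfolding snoc.IH by (auto simp: max_def)
qed

text \<open>The heaviest survivor carries at least the average \<open>(1 - q) / card A\<close>,
  where \<open>q\<close> is the mass already outside \<open>A\<close>. Adding all of
  \<open>q\<close> at least restores the missing \<open>q / card A\<close>.\<close>

lemma eliminated_mass_ge:
  assumes "x \<in> prob_simplex" and "2 \<le> card A"
  shows "1 / real (card A) \<le> (\<Sum>i \<in> - eliminate A x. x $ i)"
proof -
  define h where "h = arg_min_on (\<lambda>i. - x $ i) A"
  define q where "q = (\<Sum>i \<in> - A. x $ i)"
  have "A \<noteq> {}"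
    using assms(2) by auto
  then have h: "h \<in> A" "\<And>k. k \<in> A \<Longrightarrow> x $ k \<le> x $ h"
    unfolding h_def by (auto intro: heaviest_coordinate)
  have "q \<ge> 0"
    unfolding q_def using assms(1) by (intro sum_nonneg) (auto simp: prob_simplex_def)
  have "(\<Sum>i \<in> A. x $ i) + q = 1"
    using assms(1) sum.subset_diff[of A UNIV "\<lambda>i. x $ i"]
    by (simp add: q_def prob_simplex_def Compl_eq_Diff_UNIV)
  moreover have "(\<Sum>i \<in> A. x $ i) \<le> real (card A) * x $ h"
    using sum_bounded_above[of A "\<lambda>i. x $ i" "x $ h"] h(2) by simp
  moreover have "q \<le> real (card A) * q"
    using mult_right_mono[of 1 "real (card A)" q] assms(2) \<open>q \<ge> 0\<close> by simp
  ultimately have "1 \<le> real (card A) * (x $ h + q)"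
    by (simp add: distrib_left)
  then have "1 / real (card A) \<le> x $ h + q"
    using assms(2) by (simp add: divide_le_eq mult.commute)
  also have "- eliminate A x = insert h (- A)"
    using assms(2) h(1) by (auto simp: eliminate_def h_def)
  then have "x $ h + q = (\<Sum>i \<in> - eliminate A x. x $ i)"
    using h(1) by (simp add: q_def)
  finally show ?thesis .
qed

text \<open>Since \<open>x\<close> has total mass 1, subtracting the \<open>- 1\<close> at
  \<open>j\<close> shifts every coefficient up by 1: they become 0 on \<open>A\<close> and 2 off
  \<open>A\<close>.\<close>

lemma elimination_loss_gap:
  assumes "x \<in> prob_simplex" and "j \<in> A"
  shows "elimination_loss A \<bullet> x - elimination_loss A $ j = 2 * (\<Sum>i \<in> - A. x $ i)"
proof -
  have "elimination_loss A \<bullet> x - elimination_loss A $ j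
      = (\<Sum>i \<in> UNIV. elimination_loss A $ i * x $ i) + (\<Sum>i \<in> UNIV. x $ i)"
    using assms by (simp add: inner_vec_def elimination_loss_def prob_simplex_def)
  also have "\<dots> = (\<Sum>i \<in> UNIV. if i \<in> - A then 2 * x $ i else 0)"
    unfolding sum.distrib[symmetric] by (intro sum.cong) (auto simp: elimination_loss_def)
  also have "\<dots> = 2 * (\<Sum>i \<in> - A. x $ i)"
    by (simp add: sum.If_cases sum_distrib_left Compl_eq)
  finally show ?thesis .
qed

lemma elimination_loss_in_cube: "elimination_loss A \<in> loss_cube"
  by (simp add: elimination_loss_def loss_cube_def)

lemma fst_transcript_Suc:
  "fst (transcript alg adv (Suc t)) = fst (transcript alg adv t) @ [played_action alg adv (Suc t)]"
  by (simp add: played_action_def Let_def split_beta)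

lemma length_fst_transcript: "length (fst (transcript alg adv t)) = t"
  by (induction t) (simp_all add: fst_transcript_Suc del: transcript.simps(2))

lemma played_loss_Suc:
  "played_loss alg adv (Suc t) = adv (fst (transcript alg adv (Suc t)))"
  by (simp add: played_loss_def Let_def split_beta)

text \<open>The algorithm is only promised to answer legal losses legally, so the losses fed to it
  are first shown to lie in the cube.\<close>

lemma played_action_in_simplex:
  assumes "online_algorithm alg" and "\<And>xs. adv xs \<in> loss_cube"
  shows "played_action alg adv (Suc t) \<in> prob_simplex"
proof -
  have "snd (transcript alg adv t) \<in> lists loss_cube"
    by (induction t) (simp_all add: Let_def split_beta assms(2))
  then show ?thesis
    using assms(1) by (simp add: played_action_def online_algorithm_def Let_def split_beta)
qed

text \<open>The vertex \<open>axis j 1\<close> is an admissible comparator, and its loss in a round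
  is coordinate \<open>j\<close> of the loss vector.\<close>

lemma alt_regret_ge_coordinate:
  "alt_regret T x c \<ge> (\<Sum>t = 1..T. (c (t - 1) + c t) \<bullet> x t - (c (t - 1) + c t) $ j)"
proof -
  let ?L = "\<lambda>u. \<Sum>t = 1..T. (c (t - 1) + c t) \<bullet> u"
  have "axis j 1 \<in> prob_simplex"
    by (simp add: prob_simplex_def axis_def)
  moreover have "bdd_below (?L ` prob_simplex)"
    using alt_regret_min_attained[of c T] by (auto intro!: bdd_belowI2)
  ultimately have "(INF u \<in> prob_simplex. ?L u) \<le> ?L (axis j 1)"
    by (intro cINF_lower)
  then show ?thesis
    by (simp add: alt_regret_def sum_subtractf inner_axis)
qed

lemma elimination_regret:
  fixes alg :: "(real ^ 'd::finite) list \<Rightarrow> real ^ 'd"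
  defines "adv \<equiv> \<lambda>xs. elimination_loss (survivors xs)"
  assumes "online_algorithm alg" and "CARD('d) - 1 \<le> T"
  shows "alt_regret T (played_action alg adv) (played_loss alg adv)
    \<ge> 2 * ((\<Sum>m = 1..CARD('d). 1 / real m) - 1)"
proof -
  define x where "x = played_action alg adv"
  define c where "c = played_loss alg adv"
  define A where "A t = survivors (fst (transcript alg adv t))" for t
  define n where "n = CARD('d) - 1"
  have d: "CARD('d) = Suc n"
    using zero_less_card_finite[where 'a = 'd] by (simp add: n_def)
  have x: "x (Suc t) \<in> prob_simplex" for t
    unfolding x_def using assms(2)
    by (rule played_action_in_simplex) (simp add: adv_def elimination_loss_in_cube)
  have A_Suc: "A (Suc t) = eliminate (A t) (x (Suc t))" for t
    by (simp add: A_def x_def fst_transcript_Suc del: transcript.simps)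
  have card_A: "card (A t) = max 1 (Suc n - t)" for t
    by (simp add: A_def card_survivors length_fst_transcript d)
  have "0 < card (A T)"
    by (simp add: card_A)
  \<comment> \<open>The comparator is chosen in hindsight: a coordinate that survives all
    \<open>T\<close> rounds.\<close>
  then obtain j where j: "j \<in> A T"
    by (auto simp: card_gt_0_iff)
  have decr: "A T \<subseteq> A t" if "t \<le> T" for t
    using lift_Suc_antimono_le[of A t T] that by (simp add: A_Suc eliminate_subset)
  have gap: "c t \<bullet> y - c t $ j = 2 * (\<Sum>i \<in> - A t. y $ i)"
    if "t \<le> T" "y \<in> prob_simplex" for t y
  proof (cases t)
    \<comment> \<open>Both sides vanish, as \<open>c 0 = 0\<close> and \<open>A 0\<close> is
      everything, so round 1 needs no separate treatment.\<close>
    case 0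
    then show ?thesis
      by (simp add: c_def played_loss_def A_def)
  next
    case (Suc s)
    have "c t = elimination_loss (A t)"
      unfolding c_def A_def Suc played_loss_Suc by (simp add: adv_def)
    moreover have "j \<in> A t"
      using decr[OF that(1)] j by (rule subsetD)
    ultimately show ?thesis
      using elimination_loss_gap[OF that(2)] by simp
  qed
  \<comment> \<open>The move \<open>x (Suc t)\<close> is charged twice: against the old set
    \<open>A t\<close>, with a nonnegative gap, and against \<open>A (Suc t)\<close>, formed after
    seeing this very move.\<close>
  have step: "(c t + c (Suc t)) \<bullet> x (Suc t) - (c t + c (Suc t)) $ j
      \<ge> (if t < n then 2 / real (Suc n - t) else 0)" if "t < T" for t
  proof -
    have nonneg: "0 \<le> (\<Sum>i \<in> B. x (Suc t) $ i)" for B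
      using x[of t] by (intro sum_nonneg) (auto simp: prob_simplex_def)
    have "1 / real (Suc n - t) \<le> (\<Sum>i \<in> - A (Suc t). x (Suc t) $ i)" if "t < n"
    proof -
      \<comment> \<open>Here \<open>t < n\<close> leaves at least two survivors, so neither the
        \<open>max\<close> nor the guard in \<open>eliminate\<close> intervenes.\<close>
      have "card (A t) = Suc n - t" and "2 \<le> Suc n - t"
        using that card_A[of t] by auto
      then show ?thesis
        using eliminated_mass_ge[OF x, of "A t" t] by (simp only: A_Suc)
    qed
    moreover have "(c t + c (Suc t)) \<bullet> x (Suc t) - (c t + c (Suc t)) $ j
        = 2 * (\<Sum>i \<in> - A t. x (Suc t) $ i) + 2 * (\<Sum>i \<in> - A (Suc t). x (Suc t) $ i)"
      using gap[OF _ x, of t t] gap[OF _ x, of "Suc t" t] \<open>t < T\<close>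
      by (simp add: inner_add_left)
    ultimately show ?thesis
      using nonneg[of "- A t"] nonneg[of "- A (Suc t)"] by (cases "t < n") simp_all
  qed
  have "2 * ((\<Sum>m = 1..CARD('d). 1 / real m) - 1) = 2 * (\<Sum>m = 2..Suc n. 1 / real m)"
    by (simp add: d sum.atLeast_Suc_atMost numeral_2_eq_2)
  \<comment> \<open>Substitute \<open>m = Suc n - t\<close>, the number of survivors when the move
    \<open>x (Suc t)\<close> is made.\<close>
  also have "(\<Sum>m = 2..Suc n. 1 / real m) = (\<Sum>t<n. 1 / real (Suc n - t))"
    by (rule sum.reindex_bij_witness[of _ "\<lambda>t. Suc n - t" "\<lambda>m. Suc n - m"]) auto
  \<comment> \<open>Rounds beyond \<open>n\<close> are padded with 0; \<open>n \<le> T\<close>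
    ensures that all \<open>n\<close> terms fit.\<close>
  also have "2 * \<dots> = (\<Sum>t<T. if t < n then 2 / real (Suc n - t) else 0)"
    using assms(3) unfolding sum_distrib_left
    by (intro sum.mono_neutral_cong_left) (auto simp: n_def)
  also have "\<dots> \<le> (\<Sum>t<T. (c t + c (Suc t)) \<bullet> x (Suc t) - (c t + c (Suc t)) $ j)"
    using step by (intro sum_mono) auto
  also have "\<dots> = (\<Sum>t = 1..T. (c (t - 1) + c t) \<bullet> x t - (c (t - 1) + c t) $ j)"
    by (rule sum.reindex_bij_witness[of _ "\<lambda>t. t - 1" Suc]) auto
  also have "\<dots> \<le> alt_regret T x c"
    by (rule alt_regret_ge_coordinate)
  finally show ?thesis
    by (simp add: x_def c_def)
qed

text \<open>The difference converges to the Euler-Mascheroni constant, and a convergent sequence is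
  bounded.\<close>

lemma harmonic_sum_minus_ln_bounded:
  "\<exists>C. \<forall>d. \<bar>(\<Sum>m = 1..d. 1 / real m) - ln (real d)\<bar> \<le> C"
proof -
  have "Bseq (\<lambda>d. harm d - ln (real d) :: real)"
    using euler_mascheroni_convergent by (rule convergent_imp_Bseq)
  then obtain C where "\<And>d. norm (harm d - ln (real d) :: real) \<le> C"
    by (elim BseqE) blast
  then show ?thesis
    by (intro exI[of _ C]) (simp add: harm_def inverse_eq_divide)
qed

theorem theorem6:
  "(2 \<le> CARD('d::finite) \<longrightarrow>
     (\<forall>T \<ge> CARD('d) - 1. \<forall>alg :: (real ^ 'd) list \<Rightarrow> real ^ 'd. online_algorithm alg \<longrightarrow>
       (\<exists>adv. adaptive_adversary adv \<and>
         alt_regret T (played_action alg adv) (played_loss alg adv)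
           \<ge> 2 * ((\<Sum>m = 1..CARD('d). 1 / real m) - 1))))
   \<and> (\<exists>C :: real. \<forall>d :: nat. 2 \<le> d \<longrightarrow>
       \<bar>2 * ((\<Sum>m = 1..d. 1 / real m) - 1) - 2 * ln (real d)\<bar> \<le> C)"
proof (intro conjI impI allI)
  fix T and alg :: "(real ^ 'd) list \<Rightarrow> real ^ 'd"
  assume "CARD('d) - 1 \<le> T" and "online_algorithm alg"
  then show "\<exists>adv. adaptive_adversary adv \<and>
      alt_regret T (played_action alg adv) (played_loss alg adv)
        \<ge> 2 * ((\<Sum>m = 1..CARD('d). 1 / real m) - 1)"
    by (intro exI[of _ "\<lambda>xs. elimination_loss (survivors xs)"] conjI elimination_regret)
      (simp_all add: adaptive_adversary_def elimination_loss_in_cube)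
next
  obtain C where C: "\<And>d. \<bar>(\<Sum>m = 1..d. 1 / real m) - ln (real d)\<bar> \<le> C"
    using harmonic_sum_minus_ln_bounded by blast
  \<comment> \<open>Doubling gives \<open>2 * C\<close>, and the subtracted 1 contributes the
    remaining 2.\<close>
  have "\<bar>2 * ((\<Sum>m = 1..d. 1 / real m) - 1) - 2 * ln (real d)\<bar> \<le> 2 * C + 2" for d
    using C[of d] by (simp add: abs_le_iff)
  then show "\<exists>C. \<forall>d\<ge>2. \<bar>2 * ((\<Sum>m = 1..d. 1 / real m) - 1) - 2 * ln (real d)\<bar> \<le> C"
    by blast
qed

end
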